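(* Let $\ell\ge1$ be an integer, let $0\le a_1\le\cdots\le a_n$ and $0\le b_1\le\cdots\le b_n$ be real numbers, and let $$\rho_\ell(t)=\sum_{k=1}^n (t-a_k)^\ell\mathbf 1_{[a_k,\infty)}(t)-\sum_{k=1}^n (t-b_k)^\ell\mathbf 1_{[b_k,\infty)}(t).$$ Then $\sum_{k=1}^n a_k^j=\sum_{k=1}^n b_k^j$ for all integers $j$ with $0\le j\le\ell$ if and only if $\rho_\ell(t)=0$ for all $t\ge\max\{a_n,b_n\}$.
   Context: $\mathbf 1_S$ is the indicator function of $S$, and $0^0=1$ in the power sums. *)

theory Defs
  imports Complex_Main "HOL-Library.Indicator_Function"
begin

text \<open>The finite sequences $a_1, \dots, a_n$ and $b_1, \dots, b_n$ are functions on the naturals, of which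
  only the values at \<open>1, \<dots>, n\<close> are used.\<close>

definition rho :: "nat \<Rightarrow> nat \<Rightarrow> (nat \<Rightarrow> real) \<Rightarrow> (nat \<Rightarrow> real) \<Rightarrow> real \<Rightarrow> real" where
  "rho l n a b t =
     (\<Sum>k=1..n. (t - a k) ^ l * indicator {a k..} t) -
     (\<Sum>k=1..n. (t - b k) ^ l * indicator {b k..} t)"

end

theory Submission
  imports Defs
begin

text \<open>To the right of all the nodes \<open>a k\<close> and \<open>b k\<close> every indicator equals 1, so \<open>rho l n a b\<close> coincides
  there with the polynomial
  \[ \sum_{k=1}^n (t-a_k)^l - \sum_{k=1}^n (t-b_k)^l . \]
  By the binomial theorem its coefficient at \<open>t ^ i\<close> is, up to the nonzero factor
  $(-1)^{l-i}\binom{l}{i}$, the difference of the power sums of exponent \<open>l - i\<close>. As \<open>i\<close> runs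
  through \<open>0, \<dots>, l\<close>, so does \<open>l - i\<close>; hence the power sums agree up to exponent \<open>l\<close> exactly when
  this polynomial has only zero coefficients. A half-line is infinite, so that is the same as the
  polynomial vanishing on it.\<close>

lemma sum_shifted_powers_expand:
  fixes a :: "'b \<Rightarrow> 'a::comm_ring_1"
  shows "(\<Sum>k\<in>A. (t - a k) ^ l)
    = (\<Sum>i\<le>l. of_nat (l choose i) * (-1) ^ (l - i) * (\<Sum>k\<in>A. a k ^ (l - i)) * t ^ i)"
proof -
  have "(t - a k) ^ l = (\<Sum>i\<le>l. of_nat (l choose i) * (-1) ^ (l - i) * a k ^ (l - i) * t ^ i)" for k
  proof -
    have "(t - a k) ^ l = (\<Sum>i\<le>l. of_nat (l choose i) * t ^ i * (- a k) ^ (l - i))"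
      using binomial_ring[of t "- a k" l] by simp
    also have "\<dots> = (\<Sum>i\<le>l. of_nat (l choose i) * (-1) ^ (l - i) * a k ^ (l - i) * t ^ i)"
      by (intro sum.cong refl) (subst power_minus, simp add: mult_ac)
    finally show ?thesis .
  qed
  then have "(\<Sum>k\<in>A. (t - a k) ^ l)
      = (\<Sum>k\<in>A. \<Sum>i\<le>l. of_nat (l choose i) * (-1) ^ (l - i) * a k ^ (l - i) * t ^ i)"
    by simp
  also have "\<dots> = (\<Sum>i\<le>l. \<Sum>k\<in>A. of_nat (l choose i) * (-1) ^ (l - i) * a k ^ (l - i) * t ^ i)"
    by (rule sum.swap)
  finally show ?thesis
    by (simp add: sum_distrib_left sum_distrib_right)
qed

lemma polyfun_eq_0_on_half_line:
  fixes c :: "nat \<Rightarrow> real"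
  shows "(\<forall>t\<ge>M. (\<Sum>i\<le>l. c i * t ^ i) = 0) \<longleftrightarrow> (\<forall>i\<le>l. c i = 0)"
proof
  assume "\<forall>t\<ge>M. (\<Sum>i\<le>l. c i * t ^ i) = 0"
  then have "{M..} \<subseteq> {t. (\<Sum>i\<le>l. c i * t ^ i) = 0}"
    by auto
  then have "infinite {t. (\<Sum>i\<le>l. c i * t ^ i) = 0}"
    using infinite_Ici infinite_super by blast
  then show "\<forall>i\<le>l. c i = 0"
    using polyfun_finite_roots[of c l] by blast
qed simp

lemma rho_eq_beyond_nodes:
  assumes "\<And>k. k \<in> {1..n} \<Longrightarrow> a k \<le> t" and "\<And>k. k \<in> {1..n} \<Longrightarrow> b k \<le> t"
  shows "rho l n a b t = (\<Sum>k=1..n. (t - a k) ^ l) - (\<Sum>k=1..n. (t - b k) ^ l)"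
  unfolding rho_def using assms by simp

theorem lemma4p1:
  fixes l n :: nat and a b :: "nat \<Rightarrow> real"
  assumes "l \<ge> 1" and "n \<ge> 1"
    and "0 \<le> a 1" and "mono_on {1..n} a"
    and "0 \<le> b 1" and "mono_on {1..n} b"
  shows "(\<forall>j\<in>{0..l}. (\<Sum>k=1..n. a k ^ j) = (\<Sum>k=1..n. b k ^ j)) \<longleftrightarrow>
         (\<forall>t \<ge> max (a n) (b n). rho l n a b t = 0)"
proof -
  define D where "D j = (\<Sum>k=1..n. a k ^ j) - (\<Sum>k=1..n. b k ^ j)" for j
  define c where "c i = real (l choose i) * (-1) ^ (l - i) * D (l - i)" for i
  have rho_poly: "rho l n a b t = (\<Sum>i\<le>l. c i * t ^ i)" if "t \<ge> max (a n) (b n)" for t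
  proof -
    have "a k \<le> t" "b k \<le> t" if "k \<in> {1..n}" for k
      using mono_onD[OF assms(4), of k n] mono_onD[OF assms(6), of k n] that
        \<open>t \<ge> max (a n) (b n)\<close> by auto
    then have "rho l n a b t = (\<Sum>k=1..n. (t - a k) ^ l) - (\<Sum>k=1..n. (t - b k) ^ l)"
      by (rule rho_eq_beyond_nodes)
    then show ?thesis
      unfolding sum_shifted_powers_expand c_def D_def
      by (simp add: right_diff_distrib left_diff_distrib sum_subtractf)
  qed
  have "(\<forall>t \<ge> max (a n) (b n). rho l n a b t = 0) \<longleftrightarrow> (\<forall>i\<le>l. c i = 0)"
    using polyfun_eq_0_on_half_line[where M = "max (a n) (b n)" and c = c and l = l] rho_poly by simp
  also have "\<dots> \<longleftrightarrow> (\<forall>i\<le>l. D (l - i) = 0)"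
    by (simp add: c_def)
  also have "\<dots> \<longleftrightarrow> (\<forall>j\<in>{0..l}. D j = 0)"
    by (metis atLeastAtMost_iff diff_diff_cancel diff_le_self zero_le)
  finally show ?thesis
    by (simp add: D_def)
qed

end
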